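(* Let $(X,d)$ be a metric space, $(Y,\varrho)$ a complete metric space, and let $F:X\rightrightarrows Y$ be a set-valued mapping such that $(\bar x,\bar y)\in\mathrm{gph}\,F$ and the function $y\longmapsto \mathrm{dist}(\bar x,F^{-1}(y))$ is upper semicontinuous near $\bar y$. Set $$\varphi(y):=\begin{cases}\dfrac{\varrho(y,\bar y)}{\mathrm{dist}(\bar x,F^{-1}(y))}, & \text{if } y\ne\bar y,\\ 0,&\text{otherwise,}\end{cases}$$ $$\overline{|\nabla F|}{}_{\rm SeR}^{\diamond}(\bar x,\bar y):=\liminf_{y\to\bar y,\ y\notin F(\bar x)}\ \varrho(y,\bar y)\,\sup_{v\ne y}\frac{\varphi(y)-\varphi(v)}{\varrho(y,v)}.$$ Then $$\tfrac12\,\overline{|\nabla F|}{}_{\rm SeR}^{\diamond}(\bar x,\bar y)\ \le\ \mathrm{lopen}\,F(\bar x,\bar y)\ \le\ \overline{|\nabla F|}{}_{\rm SeR}^{\diamond}(\bar x,\bar y).$$ In particular, if numbers $c>0$ and $r>0$ are such that, for any $y\in\mathbb{B}[\bar y,r]\setminus F(\bar x)$, there is $v\in Y$ satisfying $$\varrho(y,\bar y)\,(\varphi(y)-\varphi(v))>c\,\varrho(y,v),$$ then $\mathrm{lopen}\,F(\bar x,\bar y)\ge c/2$.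
   Context: $F:X\rightrightarrows Y$ is a set-valued mapping (values may be empty), $\mathrm{gph}\,F=\{(x,y): y\in F(x)\}$, $F^{-1}(y)=\{x\in X: y\in F(x)\}$, $F(C)=\bigcup_{x\in C}F(x)$. $\mathbb{B}[u,r]$ and $\mathbb{B}(u,r)$ are the closed and open balls with centre $u$ and radius $r>0$. $\mathrm{dist}(x,C)=\inf\{d(x,u):u\in C\}$ with $\inf\emptyset=\infty$. $\mathrm{lopen}\,F(\bar x,\bar y)$ (modulus of openness at the point $(\bar x,\bar y)\in\mathrm{gph}\,F$) is the supremum of all $c>0$ for which there is $\varepsilon>0$ such that $\mathbb{B}[\bar y,ct]\subset F(\mathbb{B}[\bar x,t])$ for each $t\in(0,\varepsilon)$, with $\sup\emptyset=0$. The function $\varphi$ takes values in $[0,\infty]$: for $y\neq\bar y$ the quotient is $\infty$ when $\mathrm{dist}(\bar x,F^{-1}(y))=0$ and $0$ when $F^{-1}(y)=\emptyset$. Differences $\infty-\infty$ (which can only occur when $\varphi(y)=\varphi(v)=\infty$) are disregarded; they do not affect the supremum, since for $y\notin F(\bar x)$ with $\varphi(y)=\infty$ the choice $v=\bar y$ gives the value $\infty$. The limes inferior is $\liminf_{y\to\bar y,\,y\notin F(\bar x)}\psi(y)=\sup_{r>0}\inf\{\psi(y): y\in\mathbb{B}(\bar y,r)\setminus F(\bar x)\}$, understood as $\infty$ when $\bar y$ is an interior point of $F(\bar x)$. "Upper semicontinuous near $\bar y$" means upper semicontinuous on some neighborhood of $\bar y$. *)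

theory Defs
  imports "HOL-Analysis.Analysis"
begin

text \<open>Set-valued mappings are functions into sets; values may be empty.\<close>

definition gph :: "('a \<Rightarrow> 'b set) \<Rightarrow> ('a \<times> 'b) set" where
  "gph F = {(x, y). y \<in> F x}"

definition sv_inverse :: "('a \<Rightarrow> 'b set) \<Rightarrow> 'b \<Rightarrow> 'a set" where
  "sv_inverse F y = {x. y \<in> F x}"

definition sv_image :: "('a \<Rightarrow> 'b set) \<Rightarrow> 'a set \<Rightarrow> 'b set" where
  "sv_image F C = (\<Union>x\<in>C. F x)"

text \<open>Unlike the library's \<open>infdist\<close>, this distance to the empty set is \<open>\<infinity>\<close>.\<close>

definition edist :: "'a::metric_space \<Rightarrow> 'a set \<Rightarrow> ereal" where
  "edist x C = (INF u\<in>C. ereal (dist x u))"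

definition usc_at :: "'a::topological_space \<Rightarrow> ('a \<Rightarrow> ereal) \<Rightarrow> bool" where
  "usc_at y f \<longleftrightarrow> (\<forall>\<alpha>. f y < \<alpha> \<longrightarrow> (\<forall>\<^sub>F z in nhds y. f z < \<alpha>))"

definition usc_near :: "'a::topological_space \<Rightarrow> ('a \<Rightarrow> ereal) \<Rightarrow> bool" where
  "usc_near y0 f \<longleftrightarrow> (\<exists>U. open U \<and> y0 \<in> U \<and> (\<forall>y\<in>U. usc_at y f))"

text \<open>Inserting 0 only serves to make the supremum of the empty set 0 rather than
  \<open>- \<infinity>\<close>; all other elements are positive.\<close>

definition lopen :: "('a::metric_space \<Rightarrow> 'b::metric_space set) \<Rightarrow> 'a \<Rightarrow> 'b \<Rightarrow> ereal" where
  "lopen F x0 y0 = Sup (insert 0 {ereal c | c. c > 0 \<and>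
     (\<exists>\<epsilon>>0. \<forall>t. 0 < t \<and> t < \<epsilon> \<longrightarrow> cball y0 (c * t) \<subseteq> sv_image F (cball x0 t))})"

text \<open>In \<open>ereal\<close>, a positive real divided by 0 is \<open>\<infinity>\<close> and a real divided by
  \<open>\<infinity>\<close> is 0, as intended here.\<close>

definition ser_phi :: "('a::metric_space \<Rightarrow> 'b::metric_space set) \<Rightarrow> 'a \<Rightarrow> 'b \<Rightarrow> 'b \<Rightarrow> ereal" where
  "ser_phi F x0 y0 y =
     (if y \<noteq> y0 then ereal (dist y y0) / edist x0 (sv_inverse F y) else 0)"

text \<open>Points \<open>v\<close> with \<open>\<phi>(y) = \<phi>(v) = \<infinity>\<close> are excluded from the inner supremum, because
  \<open>ereal\<close> assigns the undefined difference \<open>\<infinity> - \<infinity>\<close> the value \<open>\<infinity>\<close>.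
  The outer limit is the supremum over \<open>r > 0\<close> of the infima over
  \<open>ball y0 r - F x0\<close> (so \<open>\<infinity>\<close> if \<open>y0\<close> is interior to \<open>F x0\<close>); that
  \<open>at y0 within _\<close> omits \<open>y0\<close> itself is immaterial when \<open>y0 \<in> F x0\<close>.\<close>

definition ser_slope :: "('a::metric_space \<Rightarrow> 'b::metric_space set) \<Rightarrow> 'a \<Rightarrow> 'b \<Rightarrow> ereal" where
  "ser_slope F x0 y0 =
     (let \<phi> = ser_phi F x0 y0 in
      Liminf (at y0 within - F x0) (\<lambda>y. ereal (dist y y0) *
        (SUP v\<in>{v. v \<noteq> y \<and> \<not> (\<phi> y = \<infinity> \<and> \<phi> v = \<infinity>)}. (\<phi> y - \<phi> v) / ereal (dist y v))))"

end

theory Submission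
  imports Defs
begin

text \<open>
  Openness at \<open>(x0, y0)\<close> with rate \<open>c\<close> says that every \<open>y\<close> near \<open>y0\<close> has a preimage within
  distance \<open>dist y y0 / c\<close> of \<open>x0\<close>; up to an arbitrarily small loss in \<open>c\<close> this means that
  \<open>\<phi> y \<ge> c\<close> for all \<open>y \<noteq> y0\<close> near \<open>y0\<close>, where \<open>\<phi> = ser_phi F x0 y0\<close>. Both estimates are therefore
  comparisons between lower bounds for \<open>\<phi>\<close> near \<open>y0\<close> and lower bounds for its scaled nonlocal slope.

  The upper estimate is elementary: the competitor \<open>v = y0\<close>, where \<open>\<phi>\<close> vanishes, shows that the
  scaled slope at \<open>y\<close> is at least \<open>\<phi> y\<close> (\<open>ser_phi_le_slope_term\<close>).

  For the lower estimate, suppose that from each \<open>z\<close> near \<open>y0\<close> outside \<open>F x0\<close> one can move to some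
  \<open>v\<close> that lowers \<open>\<phi>\<close> by more than \<open>c * dist z v / dist z y0\<close>, and that nevertheless \<open>\<phi> y < c / 2\<close>
  for some \<open>y \<noteq> y0\<close> close to \<open>y0\<close>. Put \<open>\<rho> = dist y y0\<close> and \<open>\<alpha> = c / (2 * \<rho>)\<close>. Upper semicontinuity of
  the distance function makes \<open>\<phi>\<close> lower semicontinuous (\<open>ser_phi_lsc\<close>), so the variational principle of
  Ekeland, started at \<open>y\<close> with slope \<open>\<alpha>\<close>, yields a point \<open>z\<close> with
  \<open>dist z y \<le> \<phi> y / \<alpha> < \<rho>\<close> from which no descent at rate \<open>\<alpha>\<close> is possible. This \<open>z\<close> differs from \<open>y0\<close>,
  it lies outside \<open>F x0\<close> because \<open>\<phi> z\<close> is finite, and \<open>dist z y0 \<le> 2 * \<rho>\<close>, so that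
  \<open>c / dist z y0 \<ge> \<alpha>\<close>: the assumed descent from \<open>z\<close> is impossible (\<open>ser_phi_ge_half\<close>). The factor
  \<open>1/2\<close> is what it costs to keep \<open>z\<close> away from \<open>y0\<close>, where \<open>\<phi>\<close> has its trivial minimum.
\<close>

section \<open>Ekeland's variational principle\<close>

lemma closed_lsc_sublevel:
  fixes h :: "'a::topological_space \<Rightarrow> 'c::linorder"
  assumes "closed S"
    and lsc: "\<And>w. w \<in> S \<Longrightarrow> c < h w \<Longrightarrow> \<forall>\<^sub>F z in nhds w. z \<in> S \<longrightarrow> c < h z"
  shows "closed {v \<in> S. h v \<le> c}"
proof -
  have nbhd: "\<forall>\<^sub>F z in nhds w. z \<in> - {v \<in> S. h v \<le> c}" if w: "w \<in> - {v \<in> S. h v \<le> c}" for w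
  proof (cases "w \<in> S")
    case True
    with w lsc[of w] have "\<forall>\<^sub>F z in nhds w. z \<in> S \<longrightarrow> c < h z" by auto
    then show ?thesis by eventually_elim auto
  next
    case False
    with \<open>closed S\<close> have "\<forall>\<^sub>F z in nhds w. z \<in> - S"
      by (intro eventually_nhds_in_open) auto
    then show ?thesis by eventually_elim auto
  qed
  have "open (- {v \<in> S. h v \<le> c})"
  proof (rule Topological_Spaces.openI)
    fix w assume "w \<in> - {v \<in> S. h v \<le> c}"
    from nbhd[OF this] show "\<exists>T. open T \<and> w \<in> T \<and> T \<subseteq> - {v \<in> S. h v \<le> c}"
      by (simp only: eventually_nhds subset_eq)
  qed
  then show ?thesis by (simp add: closed_def)
qed

text \<open>
  The relation \<open>g v + \<alpha> * dist v w \<le> g w\<close> is a partial order. Going down along it, each time to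
  within \<open>(1/2)^n\<close> of the infimum of \<open>g\<close> over the points still below, makes the lower sets shrink in
  diameter; they are closed by lower semicontinuity, so by completeness they meet in one point,
  which is minimal for the order.
\<close>

lemma ekeland_variational_principle:
  fixes g :: "'b::complete_space \<Rightarrow> real"
  assumes S: "closed S" "y \<in> S" and \<alpha>: "\<alpha> > 0"
    and nonneg: "\<And>v. v \<in> S \<Longrightarrow> 0 \<le> g v"
    and lsc: "\<And>w a. w \<in> S \<Longrightarrow> a < g w \<Longrightarrow> \<forall>\<^sub>F z in nhds w. z \<in> S \<longrightarrow> a < g z"
  obtains z where "z \<in> S" "g z + \<alpha> * dist z y \<le> g y"
    "\<And>v. v \<in> S \<Longrightarrow> v \<noteq> z \<Longrightarrow> g z < g v + \<alpha> * dist v z"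
proof -
  define A where "A w = {v \<in> S. g v + \<alpha> * dist v w \<le> g w}" for w
  have A_self: "w \<in> A w" if "w \<in> S" for w
    using that by (simp add: A_def)
  have A_trans: "A v \<subseteq> A w" if "v \<in> A w" for v w
  proof
    fix u assume u: "u \<in> A v"
    have "\<alpha> * dist u w \<le> \<alpha> * dist u v + \<alpha> * dist v w"
      using \<alpha> dist_triangle[of u w v] by (simp flip: distrib_left)
    then show "u \<in> A w" using u that by (auto simp: A_def)
  qed
  have A_closed: "closed (A w)" for w
    unfolding A_def
  proof (rule closed_lsc_sublevel[OF S(1)])
    fix u assume u: "u \<in> S" "g w < g u + \<alpha> * dist u w"
    \<comment> \<open>A level strictly between \<open>g w - \<alpha> * dist u w\<close> and \<open>g u\<close> separates the semicontinuous
      from the continuous summand.\<close>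
    define a where "a = (g u + (g w - \<alpha> * dist u w)) / 2"
    have a: "a < g u" "g w - a < \<alpha> * dist u w" using u by (simp_all add: a_def field_simps)
    have "((\<lambda>z. \<alpha> * dist z w) \<longlongrightarrow> \<alpha> * dist u w) (nhds u)"
      by (intro tendsto_intros) (simp add: filterlim_ident)
    from order_tendstoD(1)[OF this a(2)] lsc[OF u(1) a(1)]
    show "\<forall>\<^sub>F z in nhds u. z \<in> S \<longrightarrow> g w < g z + \<alpha> * dist z w"
      by eventually_elim auto
  qed
  have bdd: "bdd_below (g ` A w)" for w
    by (rule bdd_belowI[of _ 0]) (use nonneg in \<open>auto simp: A_def\<close>)
  have step: "\<exists>v. v \<in> A w \<and> g v < Inf (g ` A w) + (1/2) ^ n" if w: "w \<in> S" for w and n :: nat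
  proof -
    have "Inf (g ` A w) < Inf (g ` A w) + (1/2) ^ n" by simp
    from cInf_lessD[OF _ this] A_self[OF w] show ?thesis by blast
  qed
  \<comment> \<open>The guard \<open>n = 0\<close> makes the chosen sequence start at \<open>y\<close>.\<close>
  have "\<exists>s. \<forall>n. (s n \<in> S \<and> (n = 0 \<longrightarrow> s n = y)) \<and>
      (s (Suc n) \<in> A (s n) \<and> g (s (Suc n)) < Inf (g ` A (s n)) + (1/2) ^ n)"
  proof (rule dependent_nat_choice)
    show "\<exists>x. x \<in> S \<and> ((0::nat) = 0 \<longrightarrow> x = y)" using S by auto
    fix x and n :: nat assume "x \<in> S \<and> (n = 0 \<longrightarrow> x = y)"
    with step[of x n] obtain v where "v \<in> A x" "g v < Inf (g ` A x) + (1/2) ^ n" by auto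
    then show "\<exists>v. (v \<in> S \<and> (Suc n = 0 \<longrightarrow> v = y)) \<and>
        (v \<in> A x \<and> g v < Inf (g ` A x) + (1/2) ^ n)"
      by (auto simp: A_def)
  qed
  then obtain s where sS: "\<And>n. s n \<in> S" and s0: "s 0 = y"
    and sA: "\<And>n. s (Suc n) \<in> A (s n)"
    and sI: "\<And>n. g (s (Suc n)) < Inf (g ` A (s n)) + (1/2) ^ n"
    by blast
  have near: "\<alpha> * dist v (s (Suc n)) < (1/2) ^ n" if v: "v \<in> A (s (Suc n))" for v n
  proof -
    have "v \<in> A (s n)" using A_trans[OF sA] v by blast
    then have "Inf (g ` A (s n)) \<le> g v" by (intro cInf_lower bdd imageI)
    then show ?thesis using sI[of n] v by (auto simp: A_def)
  qed
  have small: "\<exists>n. \<forall>u\<in>A (s n). \<forall>v\<in>A (s n). dist u v < e" if "e > 0" for e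
  proof -
    obtain n where n: "(1/2 :: real) ^ n < \<alpha> * e / 2"
      using real_arch_pow_inv[of "\<alpha> * e / 2" "1/2"] \<alpha> \<open>e > 0\<close> by auto
    have "dist u v < e" if "u \<in> A (s (Suc n))" "v \<in> A (s (Suc n))" for u v
    proof -
      have "\<alpha> * dist u v \<le> \<alpha> * (dist u (s (Suc n)) + dist v (s (Suc n)))"
        using \<alpha> dist_triangle2[of u v "s (Suc n)"] by simp
      also have "\<dots> < \<alpha> * e" using near[OF that(1)] near[OF that(2)] n
        by (simp add: distrib_left)
      finally show ?thesis using \<alpha> by simp
    qed
    then show ?thesis by blast
  qed
  have anti: "antimono (\<lambda>n. A (s n))"
    using A_trans[OF sA] by (intro decseq_SucI) auto
  obtain z where z: "\<Inter> (range (\<lambda>n. A (s n))) = {z}"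
    using decreasing_closed_nest_sing[of "\<lambda>n. A (s n)"] A_closed A_self[OF sS] small
      antimonoD[OF anti] by blast
  then have zA: "z \<in> A (s n)" for n by blast
  show ?thesis
  proof
    show "z \<in> S" "g z + \<alpha> * dist z y \<le> g y" using zA[of 0] s0 by (auto simp: A_def)
    fix v assume v: "v \<in> S" "v \<noteq> z"
    show "g z < g v + \<alpha> * dist v z"
    proof (rule ccontr)
      assume "\<not> ?thesis"
      with v have "v \<in> A z" by (simp add: A_def)
      then have "v \<in> \<Inter> (range (\<lambda>n. A (s n)))" using A_trans[OF zA] by blast
      with z v show False by auto
    qed
  qed
qed

section \<open>The quotient function and its semicontinuity\<close>

lemma edist_nonneg: "0 \<le> edist x C"
  unfolding edist_def by (intro INF_greatest) simp

lemma edist_less_iff: "edist x C < e \<longleftrightarrow> (\<exists>u\<in>C. ereal (dist x u) < e)"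
  unfolding edist_def by (simp add: INF_less_iff)

lemma ser_phi_nonneg: "0 \<le> ser_phi F x0 y0 y"
  by (simp add: ser_phi_def edist_nonneg)

text \<open>
  Replacing the distance by a positive real threshold \<open>\<delta>\<close> above it turns bounds on the quotient into
  real inequalities, uniformly in the degenerate cases of distance \<open>0\<close> and \<open>\<infinity>\<close>; both
  resulting conditions are open in \<open>y\<close>.
\<close>

lemma less_ser_phi_iff:
  assumes "y \<noteq> y0" "a \<ge> 0"
  shows "ereal a < ser_phi F x0 y0 y \<longleftrightarrow>
    (\<exists>\<delta>>0. edist x0 (sv_inverse F y) < ereal \<delta> \<and> a * \<delta> < dist y y0)"
proof -
  define \<rho> where "\<rho> = dist y y0"
  have \<rho>: "\<rho> > 0" using assms by (simp add: \<rho>_def)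
  have \<phi>: "ser_phi F x0 y0 y = ereal \<rho> / edist x0 (sv_inverse F y)"
    using assms by (simp add: ser_phi_def \<rho>_def)
  show ?thesis
  proof (cases "edist x0 (sv_inverse F y)")
    case (real D)
    have D: "D \<ge> 0" using edist_nonneg[of x0 "sv_inverse F y"] real by simp
    have "ereal a < ereal \<rho> / ereal D \<longleftrightarrow> a * D < \<rho>"
      using D \<rho> by (cases "D = 0") (auto simp: field_simps)
    also have "\<dots> \<longleftrightarrow> (\<exists>\<delta>>0. D < \<delta> \<and> a * \<delta> < \<rho>)"
    proof
      assume *: "a * D < \<rho>"
      \<comment> \<open>The enlarged denominator stays positive for \<open>a = 0\<close>, and \<open>a * \<eta>\<close> uses up at most half of
        the available gap.\<close>
      define \<eta> where "\<eta> = (\<rho> - a * D) / (2 * (a + 1))"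
      have "\<eta> > 0" using * \<open>a \<ge> 0\<close> by (simp add: \<eta>_def)
      have "(a + 1) * \<eta> = (\<rho> - a * D) / 2"
        using \<open>a \<ge> 0\<close> by (simp add: \<eta>_def field_simps)
      with \<open>\<eta> > 0\<close> * have "a * (D + \<eta>) < \<rho>" by (simp add: algebra_simps)
      with \<open>\<eta> > 0\<close> D show "\<exists>\<delta>>0. D < \<delta> \<and> a * \<delta> < \<rho>" by (intro exI[of _ "D + \<eta>"]) auto
    next
      assume "\<exists>\<delta>>0. D < \<delta> \<and> a * \<delta> < \<rho>"
      then obtain \<delta> where "D < \<delta>" "a * \<delta> < \<rho>" by blast
      then show "a * D < \<rho>" using \<open>a \<ge> 0\<close> mult_left_mono[of D \<delta> a] by linarith
    qed
    finally show ?thesis using \<phi> real by (simp add: \<rho>_def)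
  next
    case PInf
    then show ?thesis using \<phi> assms by simp
  next
    case MInf
    then show ?thesis using edist_nonneg[of x0 "sv_inverse F y"] by simp
  qed
qed

text \<open>
  A threshold \<open>\<delta>\<close> that certifies \<open>a < \<phi> y\<close> keeps certifying it at nearby points, by upper
  semicontinuity of the distance and continuity of the metric.
\<close>

lemma ser_phi_lsc:
  assumes usc: "usc_at y (\<lambda>y. edist x0 (sv_inverse F y))"
    and a: "ereal a < ser_phi F x0 y0 y"
  shows "\<forall>\<^sub>F z in nhds y. ereal a < ser_phi F x0 y0 z"
proof (cases "a < 0")
  case True
  then have "ereal a < ser_phi F x0 y0 z" for z
    by (intro less_le_trans[OF _ ser_phi_nonneg]) simp
  then show ?thesis by simp
next
  case False
  with a have "y \<noteq> y0" by (auto simp: ser_phi_def)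
  with a False obtain \<delta> where \<delta>: "\<delta> > 0" "edist x0 (sv_inverse F y) < ereal \<delta>" "a * \<delta> < dist y y0"
    using less_ser_phi_iff[of y y0 a] by auto
  have "((\<lambda>z. dist z y0) \<longlongrightarrow> dist y y0) (nhds y)"
    by (intro tendsto_intros) (simp add: filterlim_ident)
  from order_tendstoD(1)[OF this \<delta>(3)] have "\<forall>\<^sub>F z in nhds y. a * \<delta> < dist z y0" .
  moreover have "\<forall>\<^sub>F z in nhds y. edist x0 (sv_inverse F z) < ereal \<delta>"
    using usc \<delta>(2) by (simp add: usc_at_def)
  ultimately show ?thesis
  proof eventually_elim
    case (elim z)
    have "0 \<le> a * \<delta>" using False \<delta>(1) by simp
    with elim have "z \<noteq> y0" by auto
    with elim False \<delta>(1) show ?case using less_ser_phi_iff[of z y0 a] by auto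
  qed
qed

lemma ser_phi_eq_infinity:
  assumes "y \<in> F x0" "y \<noteq> y0"
  shows "ser_phi F x0 y0 y = \<infinity>"
proof -
  have "edist x0 (sv_inverse F y) \<le> ereal (dist x0 x0)"
    unfolding edist_def using assms by (intro INF_lower) (simp add: sv_inverse_def)
  then have "edist x0 (sv_inverse F y) = 0"
    using edist_nonneg[of x0 "sv_inverse F y"] by (simp add: order_antisym zero_ereal_def)
  then show ?thesis using assms by (simp add: ser_phi_def divide_ereal_def)
qed

section \<open>From descent to openness\<close>

text \<open>
  Minimising over the closed ball of radius \<open>\<rho> = dist y y0\<close> about \<open>y\<close> keeps the argument in the region
  where semicontinuity is known, and intersecting with the sublevel set of \<open>y\<close> makes the function
  real-valued. Nothing is lost by this restriction: a point \<open>v\<close> obtained by descent from the minimiser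
  is reached from \<open>y\<close> by descent at rate \<open>\<alpha>\<close> as well, which forces \<open>dist v y < \<rho>\<close>, so \<open>v\<close> competes
  in the minimisation.
\<close>

lemma ser_phi_ge_half:
  fixes F :: "'a::metric_space \<Rightarrow> 'b::complete_space set"
  assumes c: "c > 0"
    and usc: "\<And>z. z \<in> ball y0 r \<Longrightarrow> usc_at z (\<lambda>y. edist x0 (sv_inverse F y))"
    and desc: "\<And>z. z \<in> ball y0 r - F x0 \<Longrightarrow> \<exists>v.
      ereal (dist z y0) * (ser_phi F x0 y0 z - ser_phi F x0 y0 v) > ereal (c * dist z v)"
    and y: "y \<noteq> y0" "2 * dist y y0 < r"
  shows "ereal (c / 2) \<le> ser_phi F x0 y0 y"
proof (rule ccontr)
  define \<phi> where "\<phi> = ser_phi F x0 y0"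
  define \<rho> where "\<rho> = dist y y0"
  define \<alpha> where "\<alpha> = c / (2 * \<rho>)"
  define S where "S = {v \<in> cball y \<rho>. \<phi> v \<le> \<phi> y}"
  define g where "g v = real_of_ereal (\<phi> v)" for v
  have \<rho>: "\<rho> > 0" using y by (simp add: \<rho>_def)
  have \<alpha>: "\<alpha> > 0" using c \<rho> by (simp add: \<alpha>_def)
  have \<phi>_nonneg: "0 \<le> \<phi> v" for v by (simp add: \<phi>_def ser_phi_nonneg)
  assume "\<not> ?thesis"
  then have \<phi>y: "\<phi> y < ereal (c / 2)" by (simp add: \<phi>_def)
  have g: "\<phi> v = ereal (g v)" if "\<phi> v \<le> \<phi> y" for v
    using that \<phi>y \<phi>_nonneg[of v] by (cases "\<phi> v") (auto simp: g_def)
  have in_ball: "dist v y0 \<le> 2 * \<rho> \<and> v \<in> ball y0 r" if "v \<in> cball y \<rho>" for v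
    using that y dist_triangle[of v y0 y] by (auto simp: \<rho>_def dist_commute)
  have gy: "g y < c / 2" using \<phi>y g[of y] by simp
  have lsc: "\<forall>\<^sub>F z in nhds w. ereal a < \<phi> z" if "w \<in> cball y \<rho>" "ereal a < \<phi> w" for w a
    using that in_ball usc unfolding \<phi>_def by (blast intro: ser_phi_lsc)
  have S_closed: "closed S"
    unfolding S_def g[OF order_refl]
  proof (rule closed_lsc_sublevel)
    fix w assume "w \<in> cball y \<rho>" "ereal (g y) < \<phi> w"
    from lsc[OF this] show "\<forall>\<^sub>F z in nhds w. z \<in> cball y \<rho> \<longrightarrow> ereal (g y) < \<phi> z"
      by eventually_elim simp
  qed simp
  have "y \<in> S" using \<rho> by (simp add: S_def)
  have g_nonneg: "0 \<le> g v" for v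
    using \<phi>_nonneg[of v] by (simp add: g_def real_of_ereal_pos)
  have g_lsc: "\<forall>\<^sub>F z in nhds w. z \<in> S \<longrightarrow> a < g z" if w: "w \<in> S" "a < g w" for w a
  proof -
    have "\<forall>\<^sub>F z in nhds w. ereal a < \<phi> z"
      using w g[of w] by (intro lsc) (auto simp: S_def)
    then show ?thesis
    proof eventually_elim
      case (elim z)
      then show ?case using g[of z] by (auto simp: S_def)
    qed
  qed
  obtain z where z: "z \<in> S" "g z + \<alpha> * dist z y \<le> g y"
    and z_min: "\<And>v. v \<in> S \<Longrightarrow> v \<noteq> z \<Longrightarrow> g z < g v + \<alpha> * dist v z"
    using ekeland_variational_principle[OF S_closed \<open>y \<in> S\<close> \<alpha> g_nonneg g_lsc] by blast
  have close: "dist v y < \<rho>" if "g v + \<alpha> * dist v y \<le> g y" for v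
  proof -
    have "\<alpha> * dist v y < \<alpha> * \<rho>" using that g_nonneg[of v] gy \<rho> by (simp add: \<alpha>_def)
    then show ?thesis using \<alpha> by simp
  qed
  have zy0: "z \<noteq> y0" using close[OF z(2)] by (auto simp: \<rho>_def dist_commute)
  have \<phi>z: "\<phi> z = ereal (g z)" "\<phi> z \<le> \<phi> y" using z(1) g by (auto simp: S_def)
  then have "z \<notin> F x0" using ser_phi_eq_infinity[of z F x0 y0] zy0 by (auto simp: \<phi>_def)
  moreover have zb: "dist z y0 \<le> 2 * \<rho>" "z \<in> ball y0 r" using in_ball z(1) by (auto simp: S_def)
  ultimately obtain v where v: "ereal (dist z y0) * (\<phi> z - \<phi> v) > ereal (c * dist z v)"
    using desc[of z] by (auto simp: \<phi>_def)
  have \<phi>v: "\<phi> v = ereal (g v)"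
  proof -
    have "\<phi> v \<noteq> \<infinity>" using v \<phi>z(1) zy0 by auto
    with \<phi>_nonneg[of v] show ?thesis by (cases "\<phi> v") (auto simp: g_def)
  qed
  have v': "c * dist z v < dist z y0 * (g z - g v)" using v \<phi>z(1) \<phi>v by simp
  have pos: "0 < g z - g v"
  proof -
    have "0 \<le> c * dist z v" using c by simp
    with v' have "0 < dist z y0 * (g z - g v)" by linarith
    then show ?thesis by (simp add: zero_less_mult_iff)
  qed
  have "c * dist z v < 2 * \<rho> * (g z - g v)"
    using v' mult_right_mono[OF zb(1), of "g z - g v"] pos by linarith
  then have v_desc: "g v + \<alpha> * dist v z < g z"
    using \<rho> by (simp add: \<alpha>_def field_simps dist_commute)
  have "\<alpha> * dist v y \<le> \<alpha> * dist v z + \<alpha> * dist z y"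
    using \<alpha> dist_triangle[of v y z] by (simp flip: distrib_left)
  with v_desc z(2) have "g v + \<alpha> * dist v y \<le> g y" by simp
  from close[OF this] have "v \<in> S"
    using pos \<phi>v \<phi>z by (auto simp: S_def dist_commute intro: order_trans[of _ "ereal (g z)"])
  then show False using z_min[of v] v_desc pos by force
qed

text \<open>
  The bound \<open>\<phi> y \<ge> c / 2\<close> only places the infimal distance to the preimages of \<open>y\<close>, which need not
  be attained, below \<open>2 * dist y y0 / c\<close>; openness thus follows for each rate \<open>a < c / 2\<close>, and the
  supremum in the modulus recovers \<open>c / 2\<close>.
\<close>

lemma lopen_ge_half:
  fixes F :: "'a::metric_space \<Rightarrow> 'b::complete_space set"
  assumes gph: "(x0, y0) \<in> gph F" and c: "c > 0" and r: "r > 0"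
    and usc: "usc_near y0 (\<lambda>y. edist x0 (sv_inverse F y))"
    and desc: "\<And>z. z \<in> ball y0 r - F x0 \<Longrightarrow> \<exists>v.
      ereal (dist z y0) * (ser_phi F x0 y0 z - ser_phi F x0 y0 v) > ereal (c * dist z v)"
  shows "ereal (c / 2) \<le> lopen F x0 y0"
proof -
  obtain U where U: "open U" "y0 \<in> U" "\<And>y. y \<in> U \<Longrightarrow> usc_at y (\<lambda>y. edist x0 (sv_inverse F y))"
    using usc by (auto simp: usc_near_def)
  then obtain r1 where r1: "r1 > 0" "ball y0 r1 \<subseteq> U" by (meson openE)
  define R where "R = min r r1"
  have R: "R > 0" using r r1 by (simp add: R_def)
  have \<phi>: "ereal (c / 2) \<le> ser_phi F x0 y0 y" if "y \<noteq> y0" "2 * dist y y0 < R" for y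
    by (rule ser_phi_ge_half[OF c _ _ that]) (use U r1 desc in \<open>auto simp: R_def\<close>)
  have open_a: "ereal a \<le> lopen F x0 y0" if a: "0 < a" "a < c / 2" for a
  proof -
    have "cball y0 (a * t) \<subseteq> sv_image F (cball x0 t)" if t: "0 < t" "t < R / (2 * a)" for t
    proof
      fix y assume "y \<in> cball y0 (a * t)"
      then have y: "dist y y0 \<le> a * t" by (simp add: dist_commute)
      show "y \<in> sv_image F (cball x0 t)"
      proof (cases "y = y0")
        case True
        then show ?thesis using gph t by (auto simp: sv_image_def gph_def intro!: bexI[of _ x0])
      next
        case False
        have "a * t < R / 2" using t(2) a(1) by (simp add: field_simps)
        with y have "2 * dist y y0 < R" by linarith
        have "ereal a < ereal (c / 2)" using a by simp
        also have "\<dots> \<le> ser_phi F x0 y0 y" by (rule \<phi>) fact+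
        finally have "ereal a < ser_phi F x0 y0 y" .
        with less_ser_phi_iff[OF False, of a F x0] a(1)
        obtain \<delta> where \<delta>: "edist x0 (sv_inverse F y) < ereal \<delta>" "a * \<delta> < dist y y0"
          by auto
        then have "a * \<delta> < a * t" using y by linarith
        then have "\<delta> < t" using a by simp
        from \<delta>(1) obtain u where "y \<in> F u" "dist x0 u < \<delta>"
          by (auto simp: edist_less_iff sv_inverse_def)
        with \<open>\<delta> < t\<close> show ?thesis by (auto simp: sv_image_def intro!: bexI[of _ u])
      qed
    qed
    moreover have "0 < R / (2 * a)" using R a by simp
    ultimately show ?thesis unfolding lopen_def using a by (intro Sup_upper) auto
  qed
  show ?thesis
  proof (rule ccontr)
    assume "\<not> ?thesis"
    then have "lopen F x0 y0 < ereal (c / 2)" by simp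
    from ereal_dense2[OF this] obtain a where a: "lopen F x0 y0 < ereal a" "ereal a < ereal (c / 2)"
      by auto
    have "0 \<le> lopen F x0 y0" unfolding lopen_def by (intro Sup_upper) simp
    then have "0 < a" using a(1) by (metis ereal_less(2) order_le_less_trans)
    with open_a[of a] a show False by (simp add: not_le[symmetric])
  qed
qed

section \<open>The two estimates\<close>

text \<open>
  If the estimate failed, some \<open>c\<close> with \<open>2 * lopen F x0 y0 < c\<close> would lie below the lower limit. The
  limes inferior and the inner supremum then unfold into the descent condition with this \<open>c\<close>, which
  forces \<open>c / 2 \<le> lopen F x0 y0\<close>.
\<close>

lemma half_slope_le_lopen:
  fixes F :: "'a::metric_space \<Rightarrow> 'b::complete_space set"
  assumes gph: "(x0, y0) \<in> gph F"
    and usc: "usc_near y0 (\<lambda>y. edist x0 (sv_inverse F y))"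
  shows "ereal (1/2) * ser_slope F x0 y0 \<le> lopen F x0 y0"
proof (rule ccontr)
  define \<phi> where "\<phi> = ser_phi F x0 y0"
  define \<psi> where "\<psi> y = ereal (dist y y0) *
    (SUP v\<in>{v. v \<noteq> y \<and> \<not> (\<phi> y = \<infinity> \<and> \<phi> v = \<infinity>)}. (\<phi> y - \<phi> v) / ereal (dist y v))" for y
  have slope: "ser_slope F x0 y0 = Liminf (at y0 within - F x0) \<psi>"
    unfolding ser_slope_def Let_def \<psi>_def[abs_def] \<phi>_def by (rule refl)
  assume "\<not> ?thesis"
  then have less: "lopen F x0 y0 < ereal (1/2) * ser_slope F x0 y0" by simp
  have nonneg: "0 \<le> lopen F x0 y0" unfolding lopen_def by (intro Sup_upper) simp
  from ereal_dense2[OF less] obtain m where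
    m: "lopen F x0 y0 < ereal m" "ereal m < ereal (1/2) * ser_slope F x0 y0" by auto
  have "0 < m" using nonneg m(1) by (metis ereal_less(2) order_le_less_trans)
  define c where "c = 2 * m"
  have c: "0 < c" using \<open>0 < m\<close> by (simp add: c_def)
  have "ereal c < ser_slope F x0 y0"
    using m(2) by (cases "ser_slope F x0 y0") (auto simp: c_def)
  then have "\<forall>\<^sub>F y in at y0 within - F x0. ereal c < \<psi> y"
    using le_Liminf_iff[of "ser_slope F x0 y0"] slope by auto
  then obtain r where r: "r > 0"
    and ev: "\<And>y. y \<notin> F x0 \<Longrightarrow> y \<noteq> y0 \<Longrightarrow> dist y y0 < r \<Longrightarrow> ereal c < \<psi> y"
    by (auto simp: eventually_at)
  have "ereal (c / 2) \<le> lopen F x0 y0"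
  proof (rule lopen_ge_half[OF gph c r usc])
    fix y assume y: "y \<in> ball y0 r - F x0"
    then have y0: "y \<noteq> y0" using gph by (auto simp: gph_def)
    with y have "ereal c < \<psi> y" by (intro ev) (auto simp: dist_commute)
    then have "ereal (c / dist y y0) <
        (SUP v\<in>{v. v \<noteq> y \<and> \<not> (\<phi> y = \<infinity> \<and> \<phi> v = \<infinity>)}. (\<phi> y - \<phi> v) / ereal (dist y v))"
      using y0 ereal_divide_less_pos[of "ereal (dist y y0)" "ereal c"] by (simp add: \<psi>_def)
    then obtain v where v: "v \<noteq> y"
      "ereal (c / dist y y0) < (\<phi> y - \<phi> v) / ereal (dist y v)"
      by (auto simp: less_SUP_iff)
    have "ereal (c * dist y v) < ereal (dist y y0) * (\<phi> y - \<phi> v)"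
      using v y0 by (cases "\<phi> y - \<phi> v") (auto simp: field_simps)
    then show "\<exists>v. ereal (dist y y0) * (ser_phi F x0 y0 y - ser_phi F x0 y0 v) > ereal (c * dist y v)"
      by (auto simp: \<phi>_def)
  qed
  with m(1) show False by (simp add: c_def not_le[symmetric])
qed

text \<open>
  The competitor \<open>v = y0\<close> contributes \<open>\<phi> y / dist y y0\<close>, and it is always admissible since
  \<open>\<phi> y0 = 0\<close> is finite.
\<close>

lemma ser_phi_le_slope_term:
  assumes "y \<noteq> y0"
  shows "ser_phi F x0 y0 y \<le> ereal (dist y y0) *
    (SUP v\<in>{v. v \<noteq> y \<and> \<not> (ser_phi F x0 y0 y = \<infinity> \<and> ser_phi F x0 y0 v = \<infinity>)}.
      (ser_phi F x0 y0 y - ser_phi F x0 y0 v) / ereal (dist y v))"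
    (is "_ \<le> _ * ?S")
proof -
  have 0: "ser_phi F x0 y0 y0 = 0" by (simp add: ser_phi_def)
  have "(ser_phi F x0 y0 y - ser_phi F x0 y0 y0) / ereal (dist y y0) \<le> ?S"
    using assms 0 by (intro SUP_upper) auto
  then show ?thesis using assms 0 by (simp add: ereal_divide_le_pos)
qed

text \<open>
  Openness with rate \<open>c\<close>, applied with \<open>t = dist y y0 / c\<close>, gives a preimage of \<open>y\<close> within \<open>t\<close>
  of \<open>x0\<close>, hence \<open>\<phi> y \<ge> c\<close> for all \<open>y \<noteq> y0\<close> near \<open>y0\<close>.
\<close>

lemma lopen_le_slope: "lopen F x0 y0 \<le> ser_slope F x0 y0"
proof -
  have slope_ge: "C \<le> ser_slope F x0 y0"
    if "\<forall>\<^sub>F y in at y0 within - F x0. C \<le> ser_phi F x0 y0 y" for C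
    unfolding ser_slope_def Let_def
  proof (rule Liminf_bounded)
    have "\<forall>\<^sub>F y in at y0 within - F x0. y \<noteq> y0" by (simp add: eventually_at_filter)
    with that show "\<forall>\<^sub>F y in at y0 within - F x0. C \<le> ereal (dist y y0) *
      (SUP v\<in>{v. v \<noteq> y \<and> \<not> (ser_phi F x0 y0 y = \<infinity> \<and> ser_phi F x0 y0 v = \<infinity>)}.
        (ser_phi F x0 y0 y - ser_phi F x0 y0 v) / ereal (dist y v))"
      by eventually_elim (rule order_trans[OF _ ser_phi_le_slope_term])
  qed
  have "ereal c \<le> ser_slope F x0 y0"
    if c: "c > 0" and \<epsilon>: "\<epsilon> > 0"
      and op: "\<And>t. 0 < t \<Longrightarrow> t < \<epsilon> \<Longrightarrow> cball y0 (c * t) \<subseteq> sv_image F (cball x0 t)" for c \<epsilon>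
  proof (rule slope_ge)
    have "ereal c \<le> ser_phi F x0 y0 y" if y: "y \<noteq> y0" "dist y y0 < c * \<epsilon>" for y
    proof -
      define t where "t = dist y y0 / c"
      have t: "0 < t" "t < \<epsilon>" "c * t = dist y y0" using y c by (auto simp: t_def field_simps)
      have "y \<in> cball y0 (c * t)" using t by (simp add: dist_commute)
      with op[OF t(1,2)] obtain u where u: "dist x0 u \<le> t" "y \<in> F u"
        by (auto simp: sv_image_def)
      have "edist x0 (sv_inverse F y) \<le> ereal (dist x0 u)"
        unfolding edist_def using u by (intro INF_lower) (simp add: sv_inverse_def)
      also have "\<dots> \<le> ereal t" using u by simp
      finally have D: "edist x0 (sv_inverse F y) \<le> ereal t" .
      show ?thesis
      proof (rule ccontr)
        assume "\<not> ?thesis"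
        then have "ser_phi F x0 y0 y < ereal c" by simp
        from ereal_dense2[OF this] obtain a where
          a: "ser_phi F x0 y0 y < ereal a" "a < c" by auto
        have a0: "0 < a" using ser_phi_nonneg[of F x0 y0 y] a(1) by (metis ereal_less(2) order_le_less_trans)
        define \<delta> where "\<delta> = (t + dist y y0 / a) / 2"
        have "t < dist y y0 / a" using a a0 y c by (simp add: t_def field_simps)
        then have \<delta>: "t < \<delta>" "a * \<delta> < dist y y0" using a0 by (auto simp: \<delta>_def field_simps)
        have "edist x0 (sv_inverse F y) < ereal \<delta>" using D \<delta>(1) by (simp add: order_le_less_trans)
        then have "ereal a < ser_phi F x0 y0 y"
          using \<delta> t(1) a0 y(1) less_ser_phi_iff[of y y0 a F x0] by auto
        with a(1) show False by simp
      qed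
    qed
    moreover have "0 < c * \<epsilon>" using c \<epsilon> by simp
    ultimately show "\<forall>\<^sub>F y in at y0 within - F x0. ereal c \<le> ser_phi F x0 y0 y"
      by (auto simp: eventually_at)
  qed
  moreover have "0 \<le> ser_slope F x0 y0" by (rule slope_ge) (simp add: ser_phi_nonneg)
  ultimately show ?thesis unfolding lopen_def by (intro Sup_least) blast
qed

theorem theorem3p1:
  fixes F :: "'a::metric_space \<Rightarrow> 'b::complete_space set"
    and x0 :: 'a and y0 :: 'b
  assumes "(x0, y0) \<in> gph F"
    and "usc_near y0 (\<lambda>y. edist x0 (sv_inverse F y))"
  shows "ereal (1/2) * ser_slope F x0 y0 \<le> lopen F x0 y0 \<and>
    lopen F x0 y0 \<le> ser_slope F x0 y0 \<and>
    (\<forall>c r :: real. c > 0 \<longrightarrow> r > 0 \<longrightarrow>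
      (\<forall>y \<in> cball y0 r - F x0. \<exists>v.
         \<not> (ser_phi F x0 y0 y = \<infinity> \<and> ser_phi F x0 y0 v = \<infinity>) \<and>
         ereal (dist y y0) * (ser_phi F x0 y0 y - ser_phi F x0 y0 v) > ereal (c * dist y v)) \<longrightarrow>
      lopen F x0 y0 \<ge> ereal (c / 2))"
proof (intro conjI allI impI)
  show "ereal (1/2) * ser_slope F x0 y0 \<le> lopen F x0 y0" by (rule half_slope_le_lopen[OF assms])
  show "lopen F x0 y0 \<le> ser_slope F x0 y0" by (rule lopen_le_slope)
  fix c r :: real
  assume "c > 0" "r > 0" and *: "\<forall>y \<in> cball y0 r - F x0. \<exists>v.
         \<not> (ser_phi F x0 y0 y = \<infinity> \<and> ser_phi F x0 y0 v = \<infinity>) \<and>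
         ereal (dist y y0) * (ser_phi F x0 y0 y - ser_phi F x0 y0 v) > ereal (c * dist y v)"
  show "lopen F x0 y0 \<ge> ereal (c / 2)"
    by (rule lopen_ge_half[OF assms(1) \<open>c > 0\<close> \<open>r > 0\<close> assms(2)]) (use * in auto)
qed

end
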